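(* Let $q$ be a prime power, let $P\subseteq K_q^m$ and $Q\subseteq K_q^n$ be lattice polytopes, where $K_q^r=[0,q-2]^r\subset\mathbb{R}^r$, and let $P\times Q\subseteq K_q^{m+n}$ be their product. Then the minimum distances of the corresponding toric codes over $\mathbb{F}_q$ satisfy $$d(\mathcal{C}_{P\times Q})=d(\mathcal{C}_P)\,d(\mathcal{C}_Q).$$
   Context: A lattice polytope in $\mathbb{R}^n$ is the convex hull of a finite nonempty subset of $\mathbb{Z}^n$. For a prime power $q$, put $K_q^n=[0,q-2]^n\subset\mathbb{R}^n$. For a lattice polytope $P\subseteq K_q^n$, let $\mathcal{L}(P)$ be the $\mathbb{F}_q$-vector space of polynomials spanned by the monomials $x^m=x_1^{m_1}\cdots x_n^{m_n}$ with $m=(m_1,\dots,m_n)\in P\cap\mathbb{Z}^n$. The toric code $\mathcal{C}_P$ is the linear code of block length $(q-1)^n$ over $\mathbb{F}_q$ consisting of the vectors $(f(\xi))_{\xi\in(\mathbb{F}_q^* )^n}$ for $f\in\mathcal{L}(P)$. Its minimum distance $d(\mathcal{C}_P)$ is the minimum weight (number of nonzero coordinates) of a nonzero codeword. Equivalently, it is $d(\mathcal{C}_P)=(q-1)^n-\max_{0\ne f\in\mathcal{L}(P)}Z(f)$, where $Z(f)$ is the number of points of $(\mathbb{F}_q^* )^n$ at which $f$ vanishes. *)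

theory Defs
  imports "HOL-Analysis.Analysis" "HOL-Library.Poly_Mapping"
begin

section \<open>Lattice polytopes\<close>

definition lattice_polytope :: "(real ^ 'n::finite) set \<Rightarrow> bool" where
  "lattice_polytope P \<longleftrightarrow>
     (\<exists>S. finite S \<and> S \<noteq> {} \<and> (\<forall>v\<in>S. \<forall>i. v $ i \<in> \<int>) \<and> P = convex hull S)"

definition exponent_cube :: "nat \<Rightarrow> (real ^ 'n::finite) set" where
  "exponent_cube q = {v. \<forall>i. 0 \<le> v $ i \<and> v $ i \<le> real q - 2}"

text \<open>The space of dimension $m + n$ is \<^typ>\<open>real ^ ('m::finite + 'n::finite)\<close>; the
  concatenation below identifies it with the product of the two factors.\<close>

definition vec_append :: "'b ^ 'm::finite \<Rightarrow> 'b ^ 'n::finite \<Rightarrow> 'b ^ ('m + 'n)" where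
  "vec_append x y = (\<chi> k. case k of Inl i \<Rightarrow> x $ i | Inr j \<Rightarrow> y $ j)"

definition polytope_prod ::
  "(real ^ 'm::finite) set \<Rightarrow> (real ^ 'n::finite) set \<Rightarrow> (real ^ ('m + 'n)) set" where
  "polytope_prod P Q = {vec_append x y | x y. x \<in> P \<and> y \<in> Q}"

lemma vec_append_nth [simp]:
  "vec_append x y $ Inl i = x $ i" "vec_append x y $ Inr j = y $ j"
  by (simp_all add: vec_append_def)

lemma polytope_prod_exponent_cube:
  assumes "P \<subseteq> exponent_cube q" "Q \<subseteq> exponent_cube q"
  shows "polytope_prod P Q \<subseteq> exponent_cube q"
  using assms by (auto simp: polytope_prod_def exponent_cube_def vec_append_def subset_iff split: sum.split)

lemma lattice_polytope_prod:
  assumes "lattice_polytope P" "lattice_polytope Q"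
  shows "lattice_polytope (polytope_prod P Q)"
proof -
  obtain S T where S: "finite S" "S \<noteq> {}" "\<forall>v\<in>S. \<forall>i. v $ i \<in> \<int>" "P = convex hull S"
    and T: "finite T" "T \<noteq> {}" "\<forall>v\<in>T. \<forall>i. v $ i \<in> \<int>" "Q = convex hull T"
    using assms unfolding lattice_polytope_def by blast
  define L where "L = (\<lambda>(x, y). vec_append x y :: real ^ ('a + 'b))"
  have lin: "linear L"
    by (rule linearI) (auto simp: L_def vec_eq_iff vec_append_def split: sum.split)
  have "polytope_prod P Q = L ` (P \<times> Q)"
    by (auto simp: polytope_prod_def L_def)
  also have "P \<times> Q = convex hull (S \<times> T)"
    using S T by (simp add: convex_hull_Times)
  also have "L ` \<dots> = convex hull (L ` (S \<times> T))"
    using lin by (simp add: convex_hull_linear_image)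
  finally have "polytope_prod P Q = convex hull (L ` (S \<times> T))" .
  moreover have "\<forall>v\<in>L ` (S \<times> T). \<forall>i. v $ i \<in> \<int>"
    using S(3) T(3) by (auto simp: L_def vec_append_def split: sum.split)
  ultimately show ?thesis
    unfolding lattice_polytope_def using S(1,2) T(1,2)
    by (intro exI[of _ "L ` (S \<times> T)"]) auto
qed

section \<open>Multivariate polynomials\<close>

text \<open>The outer \<^typ>\<open>_ \<Rightarrow>\<^sub>0 _\<close> maps exponent vectors to coefficients; the ring structure is
  the one of the monoid algebra.\<close>

type_synonym ('n, 'a) mpolynomial = "('n \<Rightarrow>\<^sub>0 nat) \<Rightarrow>\<^sub>0 'a"

definition poly_scale :: "'a::field \<Rightarrow> ('n, 'a) mpolynomial \<Rightarrow> ('n, 'a) mpolynomial" where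
  "poly_scale c f = Poly_Mapping.map ((*) c) f"

interpretation mpoly: vector_space "poly_scale :: 'a::field \<Rightarrow> ('n, 'a) mpolynomial \<Rightarrow> _"
  by unfold_locales
    (simp_all add: poly_scale_def mult_map_scale_conv_mult distrib_left distrib_right
      single_add mult_single flip: mult.assoc)

definition monomial :: "('n \<Rightarrow>\<^sub>0 nat) \<Rightarrow> ('n, 'a::field) mpolynomial" where
  "monomial e = Poly_Mapping.single e 1"

definition eval :: "('n::finite, 'a::field) mpolynomial \<Rightarrow> 'a ^ 'n \<Rightarrow> 'a" where
  "eval f \<xi> =
     (\<Sum>e\<in>Poly_Mapping.keys f. Poly_Mapping.lookup f e * (\<Prod>i\<in>UNIV. \<xi> $ i ^ Poly_Mapping.lookup e i))"

section \<open>Toric codes\<close>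

definition exponent_point :: "('n::finite \<Rightarrow>\<^sub>0 nat) \<Rightarrow> real ^ 'n" where
  "exponent_point e = (\<chi> i. real (Poly_Mapping.lookup e i))"

text \<open>Exponents are natural numbers, so this has its intended meaning for \<open>P\<close> contained in the
  nonnegative orthant.\<close>

definition polynomial_space :: "(real ^ 'n::finite) set \<Rightarrow> ('n, 'a::field) mpolynomial set" where
  "polynomial_space P = mpoly.span (monomial ` {e. exponent_point e \<in> P})"

definition torus :: "('a::field ^ 'n::finite) set" where
  "torus = {\<xi>. \<forall>i. \<xi> $ i \<noteq> 0}"

text \<open>Words with coordinates indexed by \<open>I\<close> are functions on \<open>I\<close>; their values outside \<open>I\<close> play
  no role and are set to \<^const>\<open>undefined\<close> by restriction.\<close>

definition toric_code :: "(real ^ 'n::finite) set \<Rightarrow> ('a::field ^ 'n \<Rightarrow> 'a) set" where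
  "toric_code P = {restrict (eval f) torus | f. f \<in> polynomial_space P}"

definition hamming_weight :: "'i set \<Rightarrow> ('i \<Rightarrow> 'a::zero) \<Rightarrow> nat" where
  "hamming_weight I c = card {i \<in> I. c i \<noteq> 0}"

definition minimum_distance :: "'i set \<Rightarrow> ('i \<Rightarrow> 'a::zero) set \<Rightarrow> nat" where
  "minimum_distance I C = Min {hamming_weight I c | c. c \<in> C \<and> (\<exists>i\<in>I. c i \<noteq> 0)}"

end

(* A word of the code of P x Q is a matrix whose columns lie in the code of P and whose rows lie in
   the code of Q. A nonzero matrix has a nonzero column, hence at least d(C_P) nonzero rows, each of
   weight at least d(C_Q). The tensor product of two words of minimum weight attains the bound. *)
theory Submission
  imports Defs
begin

section \<open>Minimum distance of a product code\<close>

lemma hamming_weight_cong: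
  assumes "\<And>i. i \<in> I \<Longrightarrow> c i = d i"
  shows "hamming_weight I c = hamming_weight I d"
  unfolding hamming_weight_def using assms by (intro arg_cong[where f = card]) auto

text \<open>Every weight is at most \<open>card I\<close>, so this holds even for infinite
  \<open>C\<close>; together with a nonzero word it makes \<open>Min\<close> in
  \<open>minimum_distance\<close> a genuine minimum.\<close>

lemma finite_hamming_weights:
  assumes "finite I"
  shows "finite {hamming_weight I c | c. c \<in> C \<and> (\<exists>i\<in>I. c i \<noteq> 0)}"
  by (rule finite_subset[of _ "{..card I}"])
    (auto simp: hamming_weight_def intro!: card_mono assms)

lemma minimum_distance_le:
  assumes "finite I" "c \<in> C" "i \<in> I" "c i \<noteq> 0"
  shows "minimum_distance I C \<le> hamming_weight I c"
  unfolding minimum_distance_def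
  by (rule Min_le[OF finite_hamming_weights[OF assms(1)]]) (use assms in auto)

lemma minimum_distance_attained:
  assumes "finite I" "\<exists>c\<in>C. \<exists>i\<in>I. c i \<noteq> 0"
  obtains c i where "c \<in> C" "i \<in> I" "c i \<noteq> 0" "hamming_weight I c = minimum_distance I C"
proof -
  have "minimum_distance I C \<in> {hamming_weight I c | c. c \<in> C \<and> (\<exists>i\<in>I. c i \<noteq> 0)}"
    unfolding minimum_distance_def
    by (rule Min_in[OF finite_hamming_weights[OF assms(1)]]) (use assms(2) in auto)
  then show ?thesis using that by auto
qed

text \<open>Views a word on \<open>K\<close> as a matrix with rows indexed by \<open>I\<close> and
  columns by \<open>J\<close>, so that its weight can be counted row by row.\<close>

lemma hamming_weight_bij_betw_Times:
  assumes "bij_betw h (I \<times> J) K"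
  shows "hamming_weight K e = card {(i, j). i \<in> I \<and> j \<in> J \<and> e (h (i, j)) \<noteq> 0}"
proof -
  let ?A = "{(i, j). i \<in> I \<and> j \<in> J \<and> e (h (i, j)) \<noteq> 0}"
  have "{k \<in> K. e k \<noteq> 0} = h ` {p \<in> I \<times> J. e (h p) \<noteq> 0}"
    unfolding bij_betw_imp_surj_on[OF assms, symmetric] by blast
  also have "{p \<in> I \<times> J. e (h p) \<noteq> 0} = ?A"
    by auto
  finally have "{k \<in> K. e k \<noteq> 0} = h ` ?A" .
  moreover have "inj_on h ?A"
    by (rule inj_on_subset[OF bij_betw_imp_inj_on[OF assms]]) auto
  ultimately show ?thesis
    by (simp add: hamming_weight_def card_image)
qed

text \<open>The combinatorial core, for arbitrary sets of words. \<open>column\<close> and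
  \<open>row\<close> ask for agreement on the index sets only, since words of a toric code are
  \<open>undefined\<close> off the torus.\<close>

lemma minimum_distance_product:
  fixes C :: "('i \<Rightarrow> 'a::idom) set" and D :: "('j \<Rightarrow> 'a) set" and E :: "('k \<Rightarrow> 'a) set"
  assumes fin: "finite I" "finite J"
    and h: "bij_betw h (I \<times> J) K"
    and C: "\<exists>c\<in>C. \<exists>i\<in>I. c i \<noteq> 0" and D: "\<exists>d\<in>D. \<exists>j\<in>J. d j \<noteq> 0"
    and column: "\<And>e j. e \<in> E \<Longrightarrow> j \<in> J \<Longrightarrow> \<exists>c\<in>C. \<forall>i\<in>I. c i = e (h (i, j))"
    and row: "\<And>e i. e \<in> E \<Longrightarrow> i \<in> I \<Longrightarrow> \<exists>d\<in>D. \<forall>j\<in>J. d j = e (h (i, j))"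
    and tensor: "\<And>c d. c \<in> C \<Longrightarrow> d \<in> D \<Longrightarrow> \<exists>e\<in>E. \<forall>i\<in>I. \<forall>j\<in>J. e (h (i, j)) = c i * d j"
  shows "minimum_distance K E = minimum_distance I C * minimum_distance J D"
proof (rule antisym)
  have K: "finite K"
    using h fin bij_betw_finite by blast
  obtain c i where c: "c \<in> C" "i \<in> I" "c i \<noteq> 0" "hamming_weight I c = minimum_distance I C"
    using minimum_distance_attained[OF fin(1) C] .
  obtain d j where d: "d \<in> D" "j \<in> J" "d j \<noteq> 0" "hamming_weight J d = minimum_distance J D"
    using minimum_distance_attained[OF fin(2) D] .
  obtain e where e: "e \<in> E" "\<forall>i\<in>I. \<forall>j\<in>J. e (h (i, j)) = c i * d j"
    using tensor[OF c(1) d(1)] by blast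
  \<comment> \<open>Without zero divisors, the support of a tensor product is the product of the
    supports.\<close>
  have "{(i, j). i \<in> I \<and> j \<in> J \<and> e (h (i, j)) \<noteq> 0} = {i \<in> I. c i \<noteq> 0} \<times> {j \<in> J. d j \<noteq> 0}"
    using e(2) by auto
  then have weight: "hamming_weight K e = minimum_distance I C * minimum_distance J D"
    using c(4) d(4) unfolding hamming_weight_bij_betw_Times[OF h]
    by (simp add: hamming_weight_def card_cartesian_product)
  have "h (i, j) \<in> K"
    by (rule bij_betw_apply[OF h]) (simp add: c(2) d(2))
  moreover have "e (h (i, j)) \<noteq> 0"
    using c d e(2) by simp
  ultimately show "minimum_distance K E \<le> minimum_distance I C * minimum_distance J D"
    using minimum_distance_le[OF K e(1)] by (simp flip: weight)
  \<comment> \<open>For the converse inequality, the tensor word shows that \<open>E\<close> has a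
    nonzero word on \<open>K\<close>, so a word of minimum weight exists; from here on
    \<open>e\<close> denotes such a word.\<close>
  then have "\<exists>e\<in>E. \<exists>k\<in>K. e k \<noteq> 0"
    using e(1) \<open>h (i, j) \<in> K\<close> \<open>e (h (i, j)) \<noteq> 0\<close> by blast
  then obtain e k where e: "e \<in> E" "k \<in> K" "e k \<noteq> 0" "hamming_weight K e = minimum_distance K E"
    by (rule minimum_distance_attained[OF K])
  obtain i0 j0 where k: "i0 \<in> I" "j0 \<in> J" "k = h (i0, j0)"
    using e(2) bij_betw_imp_surj_on[OF h] by auto
  \<comment> \<open>The column through the nonzero entry \<open>(i0, j0)\<close> is a nonzero word,
    so its support \<open>R\<close> has at least \<open>minimum_distance I C\<close>
    elements.\<close>
  obtain c where c: "c \<in> C" "\<forall>i\<in>I. c i = e (h (i, j0))"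
    using column[OF e(1) k(2)] by blast
  define R where "R = {i \<in> I. c i \<noteq> 0}"
  have R: "minimum_distance I C \<le> card R"
    using minimum_distance_le[OF fin(1) c(1) k(1)] c(2) k e(3)
    by (simp add: hamming_weight_def R_def)
  have row_weight: "minimum_distance J D \<le> card {j \<in> J. e (h (i, j)) \<noteq> 0}" if "i \<in> R" for i
  proof -
    have "i \<in> I"
      using that by (simp add: R_def)
    then obtain d where d: "d \<in> D" "\<forall>j\<in>J. d j = e (h (i, j))"
      using row[OF e(1)] by blast
    \<comment> \<open>Row \<open>i\<close> meets column \<open>j0\<close> in the entry
      \<open>c i\<close>, which is nonzero for \<open>i\<close> in \<open>R\<close>.\<close>
    have "d j0 \<noteq> 0"
      using that c(2) d(2) k(2) unfolding R_def by auto
    then have "minimum_distance J D \<le> hamming_weight J d"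
      using minimum_distance_le[OF fin(2) d(1) k(2)] by blast
    also have "\<dots> = card {j \<in> J. e (h (i, j)) \<noteq> 0}"
      using d(2) hamming_weight_cong[of J d "\<lambda>j. e (h (i, j))"] by (simp add: hamming_weight_def)
    finally show ?thesis .
  qed
  have "minimum_distance I C * minimum_distance J D \<le> card R * minimum_distance J D"
    using R by simp
  also have "\<dots> \<le> (\<Sum>i\<in>R. card {j \<in> J. e (h (i, j)) \<noteq> 0})"
    using sum_mono[of R "\<lambda>_. minimum_distance J D"] row_weight by simp
  also have "\<dots> = card (SIGMA i:R. {j \<in> J. e (h (i, j)) \<noteq> 0})"
    using fin by (simp add: R_def)
  \<comment> \<open>Only an inequality: a row outside \<open>R\<close> vanishes in column
    \<open>j0\<close> but may have nonzero entries elsewhere.\<close>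
  also have "\<dots> \<le> card {(i, j). i \<in> I \<and> j \<in> J \<and> e (h (i, j)) \<noteq> 0}"
  proof (rule card_mono)
    show "finite {(i, j). i \<in> I \<and> j \<in> J \<and> e (h (i, j)) \<noteq> 0}"
      using fin by (intro finite_subset[OF _ finite_cartesian_product[of I J]]) auto
  qed (auto simp: R_def)
  also have "\<dots> = minimum_distance K E"
    using e(4) by (simp add: hamming_weight_bij_betw_Times[OF h])
  finally show "minimum_distance I C * minimum_distance J D \<le> minimum_distance K E" .
qed

section \<open>Evaluation of polynomials\<close>

text \<open>Extra exponents have coefficient 0. This allows a common index set for polynomials with
  different keys, as needed for sums and for scalar multiples.\<close>

lemma eval_superset:
  assumes "finite A" "Poly_Mapping.keys f \<subseteq> A"
  shows "eval f \<xi> =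
    (\<Sum>e\<in>A. Poly_Mapping.lookup f e * (\<Prod>i\<in>UNIV. \<xi> $ i ^ Poly_Mapping.lookup e i))"
  unfolding eval_def
  by (rule sum.mono_neutral_left) (use assms in \<open>auto simp: in_keys_iff\<close>)

lemma eval_zero [simp]: "eval 0 \<xi> = 0"
  by (simp add: eval_def)

lemma eval_add [simp]: "eval (f + g) \<xi> = eval f \<xi> + eval g \<xi>"
proof -
  let ?A = "Poly_Mapping.keys f \<union> Poly_Mapping.keys g"
  have "Poly_Mapping.keys (f + g) \<subseteq> ?A"
    by (rule keys_add)
  then show ?thesis
    by (simp add: eval_superset[of ?A] lookup_add distrib_right sum.distrib)
qed

lemma eval_poly_scale [simp]: "eval (poly_scale c f) \<xi> = c * eval f \<xi>"
proof -
  have lookup: "Poly_Mapping.lookup (poly_scale c f) e = c * Poly_Mapping.lookup f e" for e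
    by (simp add: poly_scale_def Poly_Mapping.map.rep_eq when_def)
  \<comment> \<open>The inclusion can be proper, namely for \<open>c = 0\<close>.\<close>
  then have "Poly_Mapping.keys (poly_scale c f) \<subseteq> Poly_Mapping.keys f"
    by (auto simp: in_keys_iff)
  then show ?thesis
    by (simp add: eval_superset[of "Poly_Mapping.keys f"] lookup sum_distrib_left mult.assoc)
qed

lemma eval_monomial [simp]: "eval (monomial e) \<xi> = (\<Prod>i\<in>UNIV. \<xi> $ i ^ Poly_Mapping.lookup e i)"
  by (simp add: eval_def monomial_def)

text \<open>Over a finite index type every function has finite support, so exponents may be
  prescribed coordinate by coordinate.\<close>

lemma exponent_of_nat_fun:
  fixes k :: "'n::finite \<Rightarrow> nat"
  obtains e where "Poly_Mapping.lookup e = k"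
  by (metis finite lookup_Abs_poly_mapping)

section \<open>Concatenation of coordinates and exponents\<close>

lemma prod_UNIV_sum:
  fixes f :: "'m::finite + 'n::finite \<Rightarrow> 'a::comm_monoid_mult"
  shows "prod f UNIV = (\<Prod>i\<in>UNIV. f (Inl i)) * (\<Prod>j\<in>UNIV. f (Inr j))"
proof -
  have "prod f UNIV = prod f (range Inl \<union> range Inr)"
    by (simp add: UNIV_sum)
  also have "\<dots> = prod f (range Inl) * prod f (range Inr)"
    by (rule prod.union_disjoint) auto
  finally show ?thesis
    by (simp add: prod.reindex)
qed

lemma vec_append_collapse: "vec_append (\<chi> i. z $ Inl i) (\<chi> j. z $ Inr j) = z"
  by (auto simp: vec_eq_iff vec_append_def split: sum.split)

lemma vec_append_eq_iff [simp]: "vec_append x y = vec_append x' y' \<longleftrightarrow> x = x' \<and> y = y'"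
  by (metis vec_append_nth vec_eq_iff)

lemma vec_append_mem_polytope_prod [simp]:
  "vec_append x y \<in> polytope_prod P Q \<longleftrightarrow> x \<in> P \<and> y \<in> Q"
  by (auto simp: polytope_prod_def)

lemma exponent_point_append:
  assumes "Poly_Mapping.lookup e = case_sum (Poly_Mapping.lookup a) (Poly_Mapping.lookup b)"
  shows "exponent_point e = vec_append (exponent_point a) (exponent_point b)"
  by (auto simp: exponent_point_def vec_eq_iff vec_append_def assms split: sum.split)

section \<open>Polynomial functions with exponents in a given set\<close>

lemma monomial_mem_polynomial_space:
  "exponent_point e \<in> P \<Longrightarrow> monomial e \<in> polynomial_space P"
  unfolding polynomial_space_def by (intro mpoly.span_base) auto

text \<open>Working with the induced functions instead of the polynomials spares the later
  inductions from constructing witness polynomials in each case.\<close>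

lemma eval_image_polynomial_space_closed:
  "(\<lambda>_. 0) \<in> eval ` polynomial_space P"
  "\<phi> \<in> eval ` polynomial_space P \<Longrightarrow> \<psi> \<in> eval ` polynomial_space P \<Longrightarrow>
    (\<lambda>\<xi>. \<phi> \<xi> + \<psi> \<xi>) \<in> eval ` polynomial_space P"
  "\<phi> \<in> eval ` polynomial_space P \<Longrightarrow> (\<lambda>\<xi>. c * \<phi> \<xi>) \<in> eval ` polynomial_space P"
proof -
  show "(\<lambda>_. 0) \<in> eval ` polynomial_space P"
    by (rule image_eqI[of _ _ 0]) (auto simp: polynomial_space_def mpoly.span_zero)
next
  assume "\<phi> \<in> eval ` polynomial_space P" "\<psi> \<in> eval ` polynomial_space P"
  then obtain f g where "f \<in> polynomial_space P" "g \<in> polynomial_space P"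
    "\<phi> = eval f" "\<psi> = eval g"
    by blast
  then show "(\<lambda>\<xi>. \<phi> \<xi> + \<psi> \<xi>) \<in> eval ` polynomial_space P"
    by (intro image_eqI[of _ _ "f + g"]) (auto simp: polynomial_space_def mpoly.span_add)
next
  assume "\<phi> \<in> eval ` polynomial_space P"
  then obtain f where "f \<in> polynomial_space P" "\<phi> = eval f"
    by blast
  then show "(\<lambda>\<xi>. c * \<phi> \<xi>) \<in> eval ` polynomial_space P"
    by (intro image_eqI[of _ _ "poly_scale c f"]) (auto simp: polynomial_space_def mpoly.span_scale)
qed

lemma monomial_function_mem:
  assumes "exponent_point e \<in> P"
  shows "(\<lambda>\<xi>. \<Prod>i\<in>UNIV. \<xi> $ i ^ Poly_Mapping.lookup e i) \<in> eval ` polynomial_space P"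
  using monomial_mem_polynomial_space[OF assms] by (auto intro!: image_eqI[of _ _ "monomial e"])

text \<open>Span induction: a property that is stable under linear combinations need only be checked
  on monomials.\<close>

lemma polynomial_space_induct [consumes 1, case_names zero add scale monomial]:
  assumes "f \<in> polynomial_space P"
    and "R 0" "\<And>f g. R f \<Longrightarrow> R g \<Longrightarrow> R (f + g)" "\<And>c f. R f \<Longrightarrow> R (poly_scale c f)"
    and "\<And>e. exponent_point e \<in> P \<Longrightarrow> R (monomial e)"
  shows "R f"
  using assms(1) unfolding polynomial_space_def
  by (rule mpoly.span_induct) (auto simp: mpoly.subspace_def assms)

section \<open>Restriction and tensor product of polynomials\<close>

lemma split_exponent:
  fixes e :: "('m::finite + 'n::finite) \<Rightarrow>\<^sub>0 nat"
  assumes "exponent_point e \<in> polytope_prod P Q"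
  obtains a b where "exponent_point a \<in> P" "exponent_point b \<in> Q"
    "Poly_Mapping.lookup e = case_sum (Poly_Mapping.lookup a) (Poly_Mapping.lookup b)"
proof -
  obtain a where "Poly_Mapping.lookup a = Poly_Mapping.lookup e \<circ> Inl"
    by (rule exponent_of_nat_fun)
  moreover obtain b where "Poly_Mapping.lookup b = Poly_Mapping.lookup e \<circ> Inr"
    by (rule exponent_of_nat_fun)
  ultimately have e: "Poly_Mapping.lookup e = case_sum (Poly_Mapping.lookup a) (Poly_Mapping.lookup b)"
    by (simp add: surjective_sum comp_def)
  then have "exponent_point a \<in> P" "exponent_point b \<in> Q"
    using assms by (simp_all add: exponent_point_append[OF e])
  then show ?thesis
    using that e by blast
qed

text \<open>Supplies the columns. For fixed \<open>y\<close> the monomial x^a y^b becomes the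
  constant y^b times x^a with \<open>a\<close> in \<open>P\<close>; linearity in \<open>f\<close>
  does the rest.\<close>

lemma eval_restrict_left:
  assumes "f \<in> polynomial_space (polytope_prod P Q)"
  shows "(\<lambda>x. eval f (vec_append x y)) \<in> eval ` polynomial_space P"
  using assms
proof (induction f rule: polynomial_space_induct)
  case (monomial e)
  then obtain a b where "exponent_point a \<in> P"
    "Poly_Mapping.lookup e = case_sum (Poly_Mapping.lookup a) (Poly_Mapping.lookup b)"
    by (rule split_exponent)
  then show ?case
    \<comment> \<open>The commutation moves the constant factor in \<open>y\<close> to the front,
      where closure under scalars expects it.\<close>
    by (simp add: prod_UNIV_sum mult.commute[of "prod _ _" "prod (\<lambda>j. y $ j ^ _ j) _"]
        eval_image_polynomial_space_closed monomial_function_mem)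
qed (simp_all add: eval_image_polynomial_space_closed)

lemma eval_restrict_right:
  assumes "f \<in> polynomial_space (polytope_prod P Q)"
  shows "(\<lambda>y. eval f (vec_append x y)) \<in> eval ` polynomial_space Q"
  using assms
proof (induction f rule: polynomial_space_induct)
  case (monomial e)
  then obtain a b where "exponent_point b \<in> Q"
    "Poly_Mapping.lookup e = case_sum (Poly_Mapping.lookup a) (Poly_Mapping.lookup b)"
    by (rule split_exponent)
  then show ?case
    by (simp add: prod_UNIV_sum eval_image_polynomial_space_closed monomial_function_mem)
qed (simp_all add: eval_image_polynomial_space_closed)

text \<open>Bilinearity is used one factor at a time: here the left factor is a fixed monomial and
  the induction runs over \<open>g\<close>. The base case is the monomial whose exponent is the
  concatenation of \<open>a\<close> and \<open>b\<close>.\<close>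

lemma eval_tensor_monomial:
  fixes g :: "('n::finite, 'a::field) mpolynomial" and a :: "'m::finite \<Rightarrow>\<^sub>0 nat"
  assumes "exponent_point a \<in> P" "g \<in> polynomial_space Q"
  shows "(\<lambda>z. eval (monomial a) (\<chi> i. z $ Inl i) * eval g (\<chi> j. z $ Inr j))
    \<in> eval ` polynomial_space (polytope_prod P Q)"
  using assms(2)
proof (induction g rule: polynomial_space_induct)
  case (scale c g)
  then show ?case
    by (simp add: mult.left_commute[of _ c] eval_image_polynomial_space_closed)
next
  case (monomial b)
  obtain e where e:
    "Poly_Mapping.lookup e = case_sum (Poly_Mapping.lookup a) (Poly_Mapping.lookup b)"
    by (rule exponent_of_nat_fun)
  have "exponent_point e \<in> polytope_prod P Q"
    using assms(1) monomial by (simp add: exponent_point_append[OF e])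
  from monomial_function_mem[OF this] show ?case
    by (simp add: e prod_UNIV_sum)
qed (simp_all add: distrib_left eval_image_polynomial_space_closed)

lemma eval_tensor:
  fixes f :: "('m::finite, 'a::field) mpolynomial" and g :: "('n::finite, 'a) mpolynomial"
  assumes "f \<in> polynomial_space P" "g \<in> polynomial_space Q"
  shows "(\<lambda>z. eval f (\<chi> i. z $ Inl i) * eval g (\<chi> j. z $ Inr j))
    \<in> eval ` polynomial_space (polytope_prod P Q)"
  using assms(1)
proof (induction f rule: polynomial_space_induct)
  case (monomial a)
  then show ?case
    using assms(2) by (rule eval_tensor_monomial)
qed (simp_all add: distrib_right mult.assoc eval_image_polynomial_space_closed)

section \<open>Toric codes of products\<close>

text \<open>A generator of the polytope is a lattice point of \<open>P\<close>, and its monomial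
  vanishes nowhere on the torus.\<close>

lemma toric_code_nonzero:
  fixes P :: "(real ^ 'n::finite) set"
  assumes "lattice_polytope P" "P \<subseteq> exponent_cube q"
  shows "\<exists>c\<in>(toric_code P :: ('a::field ^ 'n \<Rightarrow> 'a) set). \<exists>\<xi>\<in>torus. c \<xi> \<noteq> 0"
proof -
  obtain S where S: "S \<noteq> {}" "\<forall>v\<in>S. \<forall>i. v $ i \<in> \<int>" "P = convex hull S"
    using assms(1) unfolding lattice_polytope_def by blast
  then obtain v where "v \<in> S"
    by auto
  then have v: "v \<in> P" "\<And>i. v $ i \<in> \<int>"
    using S by (simp_all add: hull_inc)
  \<comment> \<open>Exponents are natural numbers; the cube provides the nonnegativity of the
    integer coordinates of \<open>v\<close>.\<close>
  have "\<exists>n. v $ i = real n" for i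
  proof -
    have "0 \<le> v $ i"
      using v(1) assms(2) by (auto simp: exponent_cube_def)
    then have "v $ i \<in> \<nat>"
      using v(2) by (simp add: Nats_altdef2)
    then show ?thesis
      by (auto elim: Nats_cases)
  qed
  then obtain k :: "'n \<Rightarrow> nat" where k: "\<And>i. v $ i = real (k i)"
    using choice[of "\<lambda>i n. v $ i = real n"] by auto
  obtain e where "Poly_Mapping.lookup e = k"
    by (rule exponent_of_nat_fun)
  then have "exponent_point e = v"
    by (simp add: exponent_point_def vec_eq_iff k)
  then have "monomial e \<in> (polynomial_space P :: ('n, 'a) mpolynomial set)"
    using v(1) by (simp add: monomial_mem_polynomial_space)
  then have "restrict (eval (monomial e)) torus \<in> (toric_code P :: ('a ^ 'n \<Rightarrow> 'a) set)"
    by (auto simp: toric_code_def)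
  \<comment> \<open>At the all-ones point every monomial takes the value 1.\<close>
  moreover have "1 \<in> (torus :: ('a ^ 'n) set)"
    by (simp add: torus_def)
  moreover from this have "restrict (eval (monomial e)) torus (1 :: 'a ^ 'n) \<noteq> 0"
    by simp
  ultimately show ?thesis
    by (intro bexI)
qed

lemma vec_append_mem_torus [simp]: "vec_append x y \<in> torus \<longleftrightarrow> x \<in> torus \<and> y \<in> torus"
  by (simp add: torus_def split_sum_all)

text \<open>The indexing of matrix entries: a point of the large torus is a pair of a row index and
  a column index.\<close>

lemma bij_betw_vec_append_torus:
  "bij_betw (\<lambda>(x, y). vec_append x y)
    ((torus :: ('a::field ^ 'm::finite) set) \<times> (torus :: ('a ^ 'n::finite) set)) torus"
proof (rule bij_betw_imageI)
  show "inj_on (\<lambda>(x, y). vec_append x y)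
    ((torus :: ('a ^ 'm) set) \<times> (torus :: ('a ^ 'n) set))"
    by (auto simp: inj_on_def)
  show "(\<lambda>(x, y). vec_append x y) `
    ((torus :: ('a ^ 'm) set) \<times> (torus :: ('a ^ 'n) set)) = torus"
  proof (intro equalityI subsetI)
    fix z :: "'a ^ ('m + 'n)" assume "z \<in> torus"
    then have "((\<chi> i. z $ Inl i), (\<chi> j. z $ Inr j)) \<in> torus \<times> torus"
      by (simp add: torus_def)
    then show "z \<in> (\<lambda>(x, y). vec_append x y) `
        ((torus :: ('a ^ 'm) set) \<times> (torus :: ('a ^ 'n) set))"
      by (rule rev_image_eqI) (simp add: vec_append_collapse)
  qed auto
qed

theorem theorem2p1:
  fixes q :: nat
    and P :: "(real ^ 'm::finite) set"
    and Q :: "(real ^ 'n::finite) set"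
  assumes "CARD('a::{field,finite}) = q"
    and "lattice_polytope P" and "P \<subseteq> exponent_cube q"
    and "lattice_polytope Q" and "Q \<subseteq> exponent_cube q"
  shows "minimum_distance torus (toric_code (polytope_prod P Q) :: ('a ^ ('m + 'n) \<Rightarrow> 'a) set) =
         minimum_distance torus (toric_code P :: ('a ^ 'm \<Rightarrow> 'a) set) *
         minimum_distance torus (toric_code Q :: ('a ^ 'n \<Rightarrow> 'a) set)"
\<comment> \<open>Rows are indexed by the torus of \<open>P\<close>, columns by that of
  \<open>Q\<close>. Finiteness of both, inherited from the finite field, is left to the closing
  \<open>simp_all\<close>.\<close>
proof (rule minimum_distance_product[OF _ _ bij_betw_vec_append_torus])
  show "\<exists>c\<in>toric_code P. \<exists>\<xi>\<in>torus. c (\<xi> :: 'a ^ 'm) \<noteq> 0"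
    using assms(2,3) by (rule toric_code_nonzero)
  show "\<exists>c\<in>toric_code Q. \<exists>\<xi>\<in>torus. c (\<xi> :: 'a ^ 'n) \<noteq> 0"
    using assms(4,5) by (rule toric_code_nonzero)
next
  fix c :: "'a ^ ('m + 'n) \<Rightarrow> 'a" and y :: "'a ^ 'n"
  assume c: "c \<in> toric_code (polytope_prod P Q)" and y: "y \<in> torus"
  then obtain f where f: "f \<in> polynomial_space (polytope_prod P Q)" "c = restrict (eval f) torus"
    unfolding toric_code_def by blast
  obtain g where "g \<in> polynomial_space P" "(\<lambda>x. eval f (vec_append x y)) = eval g"
    using eval_restrict_left[OF f(1)] by blast
  then have "g \<in> polynomial_space P" "\<forall>x. eval g x = eval f (vec_append x y)"
    by (simp_all add: fun_eq_iff)
  \<comment> \<open>With \<open>x\<close> and \<open>y\<close> in their tori,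
    \<open>vec_append x y\<close> lies in the large torus, so \<open>restrict\<close> changes
    neither side.\<close>
  then show "\<exists>d\<in>toric_code P. \<forall>x\<in>torus. d x = c (case (x, y) of (x, y) \<Rightarrow> vec_append x y)"
    using y by (intro bexI[of _ "restrict (eval g) torus"]) (auto simp: f(2) toric_code_def)
next
  fix c :: "'a ^ ('m + 'n) \<Rightarrow> 'a" and x :: "'a ^ 'm"
  assume c: "c \<in> toric_code (polytope_prod P Q)" and x: "x \<in> torus"
  then obtain f where f: "f \<in> polynomial_space (polytope_prod P Q)" "c = restrict (eval f) torus"
    unfolding toric_code_def by blast
  obtain g where "g \<in> polynomial_space Q" "(\<lambda>y. eval f (vec_append x y)) = eval g"
    using eval_restrict_right[OF f(1)] by blast
  then have "g \<in> polynomial_space Q" "\<forall>y. eval g y = eval f (vec_append x y)"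
    by (simp_all add: fun_eq_iff)
  then show "\<exists>d\<in>toric_code Q. \<forall>y\<in>torus. d y = c (case (x, y) of (x, y) \<Rightarrow> vec_append x y)"
    using x by (intro bexI[of _ "restrict (eval g) torus"]) (auto simp: f(2) toric_code_def)
next
  fix c :: "'a ^ 'm \<Rightarrow> 'a" and d :: "'a ^ 'n \<Rightarrow> 'a"
  assume "c \<in> toric_code P" "d \<in> toric_code Q"
  then obtain f g where f: "f \<in> polynomial_space P" "c = restrict (eval f) torus"
    and g: "g \<in> polynomial_space Q" "d = restrict (eval g) torus"
    unfolding toric_code_def by blast
  obtain h where h: "h \<in> polynomial_space (polytope_prod P Q)"
    "(\<lambda>z. eval f (\<chi> i. z $ Inl i) * eval g (\<chi> j. z $ Inr j)) = eval h"
    using eval_tensor[OF f(1) g(1)] by blast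
  \<comment> \<open>The two coordinate blocks of \<open>vec_append x y\<close> are \<open>x\<close>
    and \<open>y\<close> again.\<close>
  have "eval h (vec_append x y) = eval f x * eval g y" for x y
    using fun_cong[OF h(2), of "vec_append x y"] by simp
  with h(1) show "\<exists>e\<in>toric_code (polytope_prod P Q). \<forall>x\<in>torus. \<forall>y\<in>torus.
      e (case (x, y) of (x, y) \<Rightarrow> vec_append x y) = c x * d y"
    by (intro bexI[of _ "restrict (eval h) torus"]) (auto simp: f(2) g(2) toric_code_def)
qed simp_all

end
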